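(* Let $s$ be an odd prime power and $F_s$ the field of order $s$. Let $A$ be the $(s+1)\times s^2$ array with rows indexed by $i\in F_s\sqcup\{\infty\}$, columns indexed by $(t,j)\in F_s\times F_s$, and entries in the set $F_s\sqcup (F_s\times F_s)$ of $s(s+1)$ symbols, given by $$A(i,(t,j))=\begin{cases}(2t,\;2t^2+j) & \text{if } i=\infty,\\ t & \text{if } i\ne\infty \text{ and } j-i=t(1-t),\\ (t^2+j,\;t(t^2+j)+j) & \text{if } i=t \text{ and } j-i\neq t(1-t),\\ (t+i,\;t(t+i)+j) & \text{otherwise.}\end{cases}$$ Then $A$ is an $(s+1)\times s^2$ extremal triple array on $s(s+1)$ symbols, and its pair of marginals is $\mathbb{A}(PG(2,s),\infty)$.
   Context: For integers $p,q\ge 2$, $v\ge 1$, a $p\times q$ triple array on $v$ symbols is an allocation $A$ of $v$ symbols to the $pq$ positions of a $p\times q$ grid such that: (i) the symbols in each row are distinct and the symbols in each column are distinct ($A$ is binary); (ii) each symbol occurs in the same number $r=pq/v$ of positions (equi-replicate); and there are constants $\lambda_{RR},\lambda_{CC},\lambda_{RC}$ such that any two distinct rows have exactly $\lambda_{RR}$ common symbols, any two distinct columns have exactly $\lambda_{CC}$ common symbols, and any row and any column have exactly $\lambda_{RC}$ common symbols. It is extremal if $v=p+q-1$. For a binary array $A$, the row design $D_R^A$ (respectively column design $D_C^A$) is the block design whose points are the symbols of $A$ and which has one block for each row (respectively column), namely the set of symbols occurring in it. The pair $(D_R^A,D_C^A)$ is the pair of marginals of $A$. The projective plane $PG(2,s)$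 is described as follows. Its points are the elements of $F_s\times F_s$ (affine points $(X,Y)$) together with the elements of $\ell_\infty=\{\infty\}\sqcup F_s$ (points at infinity). Its lines are $\ell_\infty$ and the projective closures $\{t\}\sqcup\ell$ of the affine lines $\ell\subset F_s\times F_s$, where $t\in\ell_\infty$ is the slope of $\ell$ (so $Y=tX+j$ has slope $t$, and $X=c$ has slope $\infty$). $\mathbb{A}(PG(2,s),\infty)$ denotes the pair $(D_R,D_C)$ of block designs on the $s^2+s$ points of $PG(2,s)$ different from $\infty$, where the blocks of $D_R$ are the complements (in the point set of $PG(2,s)$) of the lines through the point $\infty$, and the blocks of $D_C$ are the lines not passing through $\infty$. *)

theory Defs
  imports "HOL-Library.Multiset" "HOL-Library.Cardinality"
begin

text \<open>An array with row index set \<open>R\<close>, column index set \<open>C\<close> and symbol set \<open>V\<close> is a function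
  \<open>A\<close> with \<open>A i j \<in> V\<close> for \<open>i \<in> R\<close>, \<open>j \<in> C\<close>; only its values on \<open>R \<times> C\<close> are relevant.\<close>

definition row_symbols :: "'c set \<Rightarrow> ('r \<Rightarrow> 'c \<Rightarrow> 'x) \<Rightarrow> 'r \<Rightarrow> 'x set" where
  "row_symbols C A i = {A i j | j. j \<in> C}"

definition col_symbols :: "'r set \<Rightarrow> ('r \<Rightarrow> 'c \<Rightarrow> 'x) \<Rightarrow> 'c \<Rightarrow> 'x set" where
  "col_symbols R A j = {A i j | i. i \<in> R}"

definition is_array ::
  "nat \<Rightarrow> nat \<Rightarrow> nat \<Rightarrow> 'r set \<Rightarrow> 'c set \<Rightarrow> 'x set \<Rightarrow> ('r \<Rightarrow> 'c \<Rightarrow> 'x) \<Rightarrow> bool" where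
  "is_array p q v R C V A \<longleftrightarrow>
     finite R \<and> finite C \<and> finite V \<and> card R = p \<and> card C = q \<and> card V = v \<and>
     (\<forall>i\<in>R. \<forall>j\<in>C. A i j \<in> V)"

definition binary_array :: "'r set \<Rightarrow> 'c set \<Rightarrow> ('r \<Rightarrow> 'c \<Rightarrow> 'x) \<Rightarrow> bool" where
  "binary_array R C A \<longleftrightarrow>
     (\<forall>i\<in>R. inj_on (\<lambda>j. A i j) C) \<and> (\<forall>j\<in>C. inj_on (\<lambda>i. A i j) R)"

definition equireplicate :: "'r set \<Rightarrow> 'c set \<Rightarrow> 'x set \<Rightarrow> ('r \<Rightarrow> 'c \<Rightarrow> 'x) \<Rightarrow> bool" where
  "equireplicate R C V A \<longleftrightarrow>
     (\<exists>r. r * card V = card R * card C \<and>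
          (\<forall>x\<in>V. card {(i, j). i \<in> R \<and> j \<in> C \<and> A i j = x} = r))"

definition triple_array ::
  "nat \<Rightarrow> nat \<Rightarrow> nat \<Rightarrow> 'r set \<Rightarrow> 'c set \<Rightarrow> 'x set \<Rightarrow> ('r \<Rightarrow> 'c \<Rightarrow> 'x) \<Rightarrow> bool" where
  "triple_array p q v R C V A \<longleftrightarrow>
     p \<ge> 2 \<and> q \<ge> 2 \<and> v \<ge> 1 \<and> is_array p q v R C V A \<and>
     binary_array R C A \<and> equireplicate R C V A \<and>
     (\<exists>lRR. \<forall>i\<in>R. \<forall>i'\<in>R. i \<noteq> i' \<longrightarrow> card (row_symbols C A i \<inter> row_symbols C A i') = lRR) \<and>
     (\<exists>lCC. \<forall>j\<in>C. \<forall>j'\<in>C. j \<noteq> j' \<longrightarrow> card (col_symbols R A j \<inter> col_symbols R A j') = lCC) \<and>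
     (\<exists>lRC. \<forall>i\<in>R. \<forall>j\<in>C. card (row_symbols C A i \<inter> col_symbols R A j) = lRC)"

definition extremal_triple_array ::
  "nat \<Rightarrow> nat \<Rightarrow> nat \<Rightarrow> 'r set \<Rightarrow> 'c set \<Rightarrow> 'x set \<Rightarrow> ('r \<Rightarrow> 'c \<Rightarrow> 'x) \<Rightarrow> bool" where
  "extremal_triple_array p q v R C V A \<longleftrightarrow> triple_array p q v R C V A \<and> v = p + q - 1"

text \<open>A block design is a point set together with a multiset of blocks, so that distinct rows
  (or columns) with the same symbols contribute separate blocks.\<close>

type_synonym 'x design = "'x set \<times> 'x set multiset"

definition row_design :: "'r set \<Rightarrow> 'c set \<Rightarrow> 'x set \<Rightarrow> ('r \<Rightarrow> 'c \<Rightarrow> 'x) \<Rightarrow> 'x design" where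
  "row_design R C V A = (V, image_mset (row_symbols C A) (mset_set R))"

definition col_design :: "'r set \<Rightarrow> 'c set \<Rightarrow> 'x set \<Rightarrow> ('r \<Rightarrow> 'c \<Rightarrow> 'x) \<Rightarrow> 'x design" where
  "col_design R C V A = (V, image_mset (col_symbols R A) (mset_set C))"

definition marginals ::
  "'r set \<Rightarrow> 'c set \<Rightarrow> 'x set \<Rightarrow> ('r \<Rightarrow> 'c \<Rightarrow> 'x) \<Rightarrow> 'x design \<times> 'x design" where
  "marginals R C V A = (row_design R C V A, col_design R C V A)"

text \<open>The set $F \sqcup \{\infty\}$ is rendered as \<open>'a option\<close>, with \<open>None\<close> for $\infty$.\<close>

datatype 'a pg_point = Affine "'a \<times> 'a" | AtInf "'a option"

definition line_at_infinity :: "'a pg_point set" where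
  "line_at_infinity = range AtInf"

fun affine_line :: "'a::field option \<Rightarrow> 'a \<Rightarrow> ('a \<times> 'a) set" where
  "affine_line None c = {(X, Y). X = c}"
| "affine_line (Some t) j = {(X, Y). Y = t * X + j}"

definition projective_closure :: "'a::field option \<Rightarrow> 'a \<Rightarrow> 'a pg_point set" where
  "projective_closure t c = insert (AtInf t) (Affine ` affine_line t c)"

definition pg_lines :: "'a::field pg_point set set" where
  "pg_lines = insert line_at_infinity {projective_closure t c | t c. True}"

text \<open>The pair of designs of a plane with point set \<open>P\<close> and line set \<open>L\<close>, punctured at \<open>x\<close>.\<close>

definition punctured_pair ::
  "'x set \<Rightarrow> 'x set set \<Rightarrow> 'x \<Rightarrow> 'x design \<times> 'x design" where
  "punctured_pair P L x =
     ((P - {x}, mset_set {P - l | l. l \<in> L \<and> x \<in> l}),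
      (P - {x}, mset_set {l \<in> L. x \<notin> l}))"

text \<open>The symbol set $F \sqcup (F \times F)$ is taken inside the point set of the plane: a symbol
  $t \in F$ is the point at infinity of slope $t$.\<close>

definition array_symbols :: "'a pg_point set" where
  "array_symbols = {AtInf (Some t) | t. True} \<union> {Affine (X, Y) | X Y. True}"

fun plane_array :: "'a::field option \<Rightarrow> 'a \<times> 'a \<Rightarrow> 'a pg_point" where
  "plane_array None (t, j) = Affine (2 * t, 2 * t\<^sup>2 + j)"
| "plane_array (Some i) (t, j) =
     (if j - i = t * (1 - t) then AtInf (Some t)
      else if i = t then Affine (t\<^sup>2 + j, t * (t\<^sup>2 + j) + j)
      else Affine (t + i, t * (t + i) + j))"

end

(* Column (t, j) consists of the points of the line Y = tX + j: as the row index i runs through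
   F and infinity, the X-coordinate runs through F, except that the row i = j - t + t^2, where
   X would be t^2 + j, receives the point at infinity instead, the displaced X = t^2 + j being
   moved to row t and X = 2t to the row at infinity.  Row i is the complement of the line
   X = 2i: the point with X = t + i missed in column (t, i + t - t^2) lies on the line
   Y = (i + 1)X - i^2, which is exactly what the columns (i, j) supply.  As 2 is invertible, the
   rows thus correspond to the lines through infinity.  All rows and columns have the largest
   possible number of symbols, so the array is binary, and the remaining parameters count
   points of the plane. *)

theory Submission imports Defs begin

section \<open>Finite fields: invertibility of 2 and the bound on the order\<close>

text \<open>Translation by 1 permutes the field, so it preserves the sum of all elements, and
  \<open>CARD('a)\<close> copies of 1 add up to 0. If 2 were 0, an odd number of copies would add up
  to 1.\<close>

lemma two_neq_zero_if_odd_card: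
  assumes "odd CARD('a::{field,finite})"
  shows "(2::'a) \<noteq> 0"
proof
  assume two: "(2::'a) = 0"
  have "(\<Sum>x\<in>UNIV. x + 1) = (\<Sum>x\<in>(UNIV::'a set). x)"
    by (rule sum.reindex_bij_witness[of _ "\<lambda>x. x - 1" "\<lambda>x. x + 1"]) auto
  then have "of_nat CARD('a) = (0::'a)"
    by (simp add: sum.distrib)
  moreover obtain k where "CARD('a) = 2 * k + 1"
    using assms by (elim oddE)
  ultimately show False
    using two by simp
qed

lemma card_field_ge_2: "CARD('a::{field,finite}) \<ge> 2"
  using card_mono[of UNIV "{0::'a, 1}"] by simp

text \<open>The line through \<open>AtInf None\<close> that row \<open>i\<close> turns out to avoid.
  Distinct rows get distinct lines only when 2 is nonzero.\<close>

fun punctured_line :: "'a::field option \<Rightarrow> 'a pg_point set" where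
  "punctured_line None = line_at_infinity"
| "punctured_line (Some i) = projective_closure None (2 * i)"

abbreviation rsym :: "'a::field option \<Rightarrow> 'a pg_point set" where
  "rsym \<equiv> row_symbols UNIV plane_array"

abbreviation csym :: "'a::field \<times> 'a \<Rightarrow> 'a pg_point set" where
  "csym \<equiv> col_symbols UNIV plane_array"

lemma mem_projective_closure [simp]:
  "AtInf u \<in> projective_closure t c \<longleftrightarrow> u = t"
  "Affine P \<in> projective_closure t c \<longleftrightarrow> P \<in> affine_line t c"
  by (auto simp: projective_closure_def)

lemma mem_line_at_infinity [simp]:
  "AtInf u \<in> line_at_infinity" "Affine P \<notin> line_at_infinity"
  by (auto simp: line_at_infinity_def)

text \<open>Matches the symbols with the point set \<open>P - {x}\<close> of
  \<open>punctured_pair\<close>.\<close>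

lemma array_symbols_eq: "array_symbols = UNIV - {AtInf None}"
proof (rule set_eqI)
  fix x :: "'a pg_point"
  show "x \<in> array_symbols \<longleftrightarrow> x \<in> UNIV - {AtInf None}"
  proof (cases x)
    case (AtInf u)
    then show ?thesis by (cases u) (auto simp: array_symbols_def)
  qed (auto simp: array_symbols_def)
qed

section \<open>Columns as lines, rows as complements of lines\<close>

lemma col_symbols_plane_array:
  fixes t j :: "'a::field"
  shows "csym (t, j) = projective_closure (Some t) j"
proof
  show "csym (t, j) \<subseteq> projective_closure (Some t) j"
  proof
    fix x assume "x \<in> csym (t, j)"
    then obtain i where "x = plane_array i (t, j)"
      by (auto simp: col_symbols_def)
    then show "x \<in> projective_closure (Some t) j"
      by (cases i) (auto simp: power2_eq_square)
  qed
  show "projective_closure (Some t) j \<subseteq> csym (t, j)"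
  proof
    fix x assume x: "x \<in> projective_closure (Some t) j"
    have "\<exists>i. x = plane_array i (t, j)"
    proof (cases x)
      case (AtInf u)
      then show ?thesis
        using x by (intro exI[of _ "Some (j - t * (1 - t))"]) simp
    next
      case (Affine P)
      obtain X where P: "P = (X, t * X + j)"
        using x Affine by (cases P) auto
      consider "X = 2 * t" | "X \<noteq> 2 * t" "X = t\<^sup>2 + j" | "X \<noteq> 2 * t" "X \<noteq> t\<^sup>2 + j"
        by blast
      then show ?thesis
      proof cases
        case 1
        then show ?thesis using Affine P
          by (intro exI[of _ None]) (simp add: power2_eq_square)
      next
        case 2
        \<comment> \<open>Equality here would say \<open>t * t + j = 2 * t\<close>, that is, the
          displaced point would be the one already placed in row \<open>None\<close>.\<close>
        then have "j - t \<noteq> t * (1 - t)"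
          by (auto simp: algebra_simps power2_eq_square)
        then show ?thesis using Affine P 2
          by (intro exI[of _ "Some t"]) simp
      next
        case 3
        then have "j - (X - t) \<noteq> t * (1 - t)" "X - t \<noteq> t"
          by (auto simp: algebra_simps power2_eq_square)
        then show ?thesis using Affine P
          by (intro exI[of _ "Some (X - t)"]) simp
      qed
    qed
    then show "x \<in> csym (t, j)"
      by (auto simp: col_symbols_def)
  qed
qed

text \<open>The abscissa \<open>2 * t\<close> runs through the whole field because 2 is invertible;
  \<open>j\<close> then adjusts the ordinate freely.\<close>

lemma row_symbols_plane_array_None:
  assumes "(2::'a::field) \<noteq> 0"
  shows "rsym (None :: 'a option) = UNIV - line_at_infinity"
proof
  show "rsym (None :: 'a option) \<subseteq> UNIV - line_at_infinity"
    by (auto simp: row_symbols_def)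
  show "UNIV - line_at_infinity \<subseteq> rsym (None :: 'a option)"
  proof
    fix x :: "'a pg_point" assume "x \<in> UNIV - line_at_infinity"
    then obtain X Y where "x = Affine (X, Y)"
      by (cases x) auto
    then have "x = plane_array None (X / 2, Y - 2 * (X / 2)\<^sup>2)"
      using assms by simp
    then show "x \<in> rsym None"
      unfolding row_symbols_def by blast
  qed
qed

lemma row_symbols_plane_array_Some:
  fixes i :: "'a::field"
  shows "rsym (Some i) = UNIV - projective_closure None (2 * i)"
proof
  show "rsym (Some i) \<subseteq> UNIV - projective_closure None (2 * i)"
  proof
    fix x assume "x \<in> rsym (Some i)"
    then obtain t j where "x = plane_array (Some i) (t, j)"
      by (auto simp: row_symbols_def)
    then show "x \<in> UNIV - projective_closure None (2 * i)"
      by (auto simp: algebra_simps power2_eq_square)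
  qed
  show "UNIV - projective_closure None (2 * i) \<subseteq> rsym (Some i)"
  proof
    fix x assume x: "x \<in> UNIV - projective_closure None (2 * i)"
    have "\<exists>t j. x = plane_array (Some i) (t, j)"
    proof (cases x)
      case (AtInf u)
      then obtain t where "u = Some t"
        using x by (cases u) auto
      then show ?thesis
        using AtInf by (intro exI[of _ t] exI[of _ "i + t * (1 - t)"]) simp
    next
      case (Affine P)
      obtain X Y where P: "P = (X, Y)" by (cases P)
      have X: "X \<noteq> 2 * i" using x Affine P by auto
      show ?thesis
      \<comment> \<open>The generic entry has abscissa \<open>t + i\<close>, which forces
        \<open>t = X - i\<close>. The column of that slope through the point carries its point at
        infinity in row \<open>i\<close> exactly when this equation holds; the column must then have
        slope \<open>i\<close>.\<close>
      proof (cases "Y = (i + 1) * X - i\<^sup>2")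
        case True
        have "X - i\<^sup>2 - i \<noteq> i * (1 - i)"
          using X by (auto simp: algebra_simps power2_eq_square)
        then show ?thesis using Affine P True
          by (intro exI[of _ i] exI[of _ "X - i\<^sup>2"]) (simp add: algebra_simps)
      next
        case False
        have "Y - (X - i) * X - i \<noteq> (X - i) * (1 - (X - i))"
          using False by (auto simp: algebra_simps power2_eq_square)
        moreover have "i \<noteq> X - i"
          using X by (auto simp: algebra_simps)
        ultimately show ?thesis using Affine P
          by (intro exI[of _ "X - i"] exI[of _ "Y - (X - i) * X"]) simp
      qed
    qed
    then show "x \<in> rsym (Some i)"
      unfolding row_symbols_def by blast
  qed
qed

lemma row_symbols_plane_array:
  assumes "(2::'a::field) \<noteq> 0"
  shows "rsym (i :: 'a option) = UNIV - punctured_line i"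
  using assms by (cases i) (simp_all add: row_symbols_plane_array_None row_symbols_plane_array_Some)

section \<open>Counting points and intersections in the plane\<close>

lemma UNIV_pg_point: "(UNIV :: 'a pg_point set) = range Affine \<union> range AtInf"
  by (auto intro: pg_point.exhaust)

lemma finite_UNIV_pg_point [simp]: "finite (UNIV :: 'a::finite pg_point set)"
  by (simp add: UNIV_pg_point)

lemma finite_pg_point_set [simp]: "finite (A :: 'a::finite pg_point set)"
  by (rule finite_subset[OF subset_UNIV finite_UNIV_pg_point])

lemma card_UNIV_pg_point:
  "card (UNIV :: 'a::finite pg_point set) = CARD('a)\<^sup>2 + CARD('a) + 1"
proof -
  have "card (UNIV :: 'a pg_point set)
      = card (range (Affine :: 'a \<times> 'a \<Rightarrow> _)) + card (range (AtInf :: 'a option \<Rightarrow> _))"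
    unfolding UNIV_pg_point by (intro card_Un_disjoint) auto
  also have "\<dots> = CARD('a \<times> 'a) + CARD('a option)"
    by (subst (1 2) card_image) (auto simp: inj_on_def)
  finally show ?thesis
    by (simp add: power2_eq_square)
qed

lemma card_projective_closure [simp]:
  "card (projective_closure t (c :: 'a::{field,finite})) = CARD('a) + 1"
proof -
  have "card (affine_line t c) = CARD('a)"
  proof (cases t)
    case None
    have "affine_line t c = Pair c ` UNIV" using None by auto
    then show ?thesis by (simp add: card_image inj_on_def)
  next
    case (Some u)
    have "affine_line t c = (\<lambda>X. (X, u * X + c)) ` UNIV" using Some by auto
    then show ?thesis by (simp add: card_image inj_on_def)
  qed
  moreover have "projective_closure t c = insert (AtInf t) (Affine ` affine_line t c)"
    by (rule projective_closure_def)
  ultimately show ?thesis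
    by (simp add: card_insert_if card_image inj_on_def image_iff)
qed

lemma card_punctured_line [simp]:
  "card (punctured_line (i :: 'a::{field,finite} option)) = CARD('a) + 1"
  by (cases i) (simp_all add: line_at_infinity_def card_image inj_on_def)

text \<open>All these lines pass through \<open>AtInf None\<close>. Since 2 is nonzero, the vertical
  ones have different abscissas and share no affine point.\<close>

lemma punctured_line_Int:
  assumes "(2::'a::field) \<noteq> 0" "i \<noteq> i'"
  shows "punctured_line (i :: 'a option) \<inter> punctured_line i' = {AtInf None}"
proof (rule set_eqI)
  fix x :: "'a pg_point"
  show "x \<in> punctured_line i \<inter> punctured_line i' \<longleftrightarrow> x \<in> {AtInf None}"
    using assms by (cases i; cases i'; cases x) auto
qed

text \<open>Parallel lines share only their point at infinity; lines of different slopes share only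
  the affine point given by a linear equation.\<close>

lemma card_projective_closure_Int:
  fixes t j t' j' :: "'a::field"
  assumes "(t, j) \<noteq> (t', j')"
  shows "card (projective_closure (Some t) j \<inter> projective_closure (Some t') j') = 1"
proof (cases "t = t'")
  case True
  then have "x \<in> projective_closure (Some t) j \<inter> projective_closure (Some t') j'
      \<longleftrightarrow> x \<in> {AtInf (Some t)}" for x
    using assms by (cases x) auto
  then have "projective_closure (Some t) j \<inter> projective_closure (Some t') j' = {AtInf (Some t)}"
    by blast
  then show ?thesis by simp
next
  case False
  define X where "X = (j' - j) / (t - t')"
  have *: "t * Z + j = t' * Z + j' \<longleftrightarrow> Z = X" for Z
    using False by (simp add: X_def field_simps)
  then have "x \<in> projective_closure (Some t) j \<inter> projective_closure (Some t') j'
      \<longleftrightarrow> x \<in> {Affine (X, t * X + j)}" for x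
    using False by (cases x) auto
  then have "projective_closure (Some t) j \<inter> projective_closure (Some t') j'
      = {Affine (X, t * X + j)}"
    by blast
  then show ?thesis by simp
qed

lemma card_punctured_line_Int:
  fixes t j :: "'a::field"
  shows "card (projective_closure (Some t) j \<inter> punctured_line i) = 1"
proof -
  \<comment> \<open>A non-vertical line is a graph over the X-axis, so it has one point at each
    abscissa \<open>2 * k\<close>, besides its point at infinity.\<close>
  define y where "y = (case i of None \<Rightarrow> AtInf (Some t) | Some k \<Rightarrow> Affine (2 * k, t * (2 * k) + j))"
  have "x \<in> projective_closure (Some t) j \<inter> punctured_line i \<longleftrightarrow> x \<in> {y}" for x
    by (cases i; cases x) (auto simp: y_def)
  then have "projective_closure (Some t) j \<inter> punctured_line i = {y}"
    by blast
  then show ?thesis by simp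
qed

section \<open>Symbol counts of the array\<close>

lemma card_row_symbols_plane_array:
  assumes "(2::'a::{field,finite}) \<noteq> 0"
  shows "card (rsym (i :: 'a option)) = CARD('a)\<^sup>2"
  by (simp add: row_symbols_plane_array[OF assms] card_Diff_subset card_UNIV_pg_point)

text \<open>By counting: the image has as many elements as the row has cells.\<close>

lemma inj_on_plane_array_row:
  assumes "(2::'a::{field,finite}) \<noteq> 0"
  shows "inj (plane_array (i :: 'a option))"
proof (rule eq_card_imp_inj_on)
  have "range (plane_array i) = rsym i"
    by (auto simp: row_symbols_def)
  then show "card (range (plane_array i)) = card (UNIV :: ('a \<times> 'a) set)"
    using card_row_symbols_plane_array[OF assms, of i] by (simp add: power2_eq_square)
qed simp

lemma inj_on_plane_array_col:
  "inj (\<lambda>i. plane_array i (c :: 'a::{field,finite} \<times> 'a))"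
proof (rule eq_card_imp_inj_on)
  have "range (\<lambda>i. plane_array i c) = csym c"
    by (auto simp: col_symbols_def)
  then show "card (range (\<lambda>i. plane_array i c)) = card (UNIV :: 'a option set)"
    by (cases c) (simp add: col_symbols_plane_array)
qed simp

lemma card_rows_containing:
  assumes "(2::'a::{field,finite}) \<noteq> 0" "x \<noteq> AtInf None"
  shows "card {i :: 'a option. x \<in> rsym i} = CARD('a)"
proof -
  \<comment> \<open>Exactly one line joins \<open>x\<close> to \<open>AtInf None\<close>;
    \<open>k\<close> is the row avoiding it. Its abscissa \<open>2 * k\<close> has to be that of
    \<open>x\<close>, hence the halving.\<close>
  define k where "k = (case x of AtInf u \<Rightarrow> None | Affine P \<Rightarrow> Some (fst P / 2))"
  have "x \<in> rsym i \<longleftrightarrow> i \<noteq> k" for i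
    unfolding row_symbols_plane_array[OF assms(1)]
    using assms by (cases i; cases x) (auto simp: k_def)
  then have "{i. x \<in> rsym i} = UNIV - {k}"
    by auto
  then show ?thesis
    by (simp add: card_Diff_subset)
qed

text \<open>Rows are injective, so a cell containing \<open>x\<close> is determined by its row, and
  it suffices to count the rows in which \<open>x\<close> occurs.\<close>

lemma card_occurrences:
  assumes "(2::'a::{field,finite}) \<noteq> 0" "x \<noteq> AtInf None"
  shows "card {(i :: 'a option, c). plane_array i c = x} = CARD('a)"
proof -
  let ?S = "{(i :: 'a option, c). plane_array i c = x}"
  have "inj_on fst ?S"
    using injD[OF inj_on_plane_array_row[OF assms(1)]]
    by (intro inj_onI) (clarsimp, metis)
  moreover have "fst ` ?S = {i. x \<in> rsym i}"
    by (force simp: row_symbols_def)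
  ultimately have "card ?S = card {i. x \<in> rsym i}"
    by (metis card_image)
  also have "\<dots> = CARD('a)"
    by (rule card_rows_containing[OF assms])
  finally show ?thesis .
qed

lemma card_row_Int_row:
  assumes "(2::'a::{field,finite}) \<noteq> 0" "i \<noteq> i'"
  shows "card (rsym (i :: 'a option) \<inter> rsym i') = CARD('a)\<^sup>2 - CARD('a)"
proof -
  \<comment> \<open>The two lines share one point; it is added on the left to avoid subtraction on
    naturals.\<close>
  have "card (punctured_line i \<union> punctured_line i') + 1 = 2 * (CARD('a) + 1)"
    using card_Un_Int[of "punctured_line i" "punctured_line i'"]
    by (simp add: punctured_line_Int[OF assms])
  moreover have "rsym i \<inter> rsym i' = UNIV - (punctured_line i \<union> punctured_line i')"
    unfolding row_symbols_plane_array[OF assms(1)] by blast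
  ultimately show ?thesis
    by (simp add: card_Diff_subset card_UNIV_pg_point)
qed

text \<open>The column is a line with \<open>CARD('a) + 1\<close> points, of which the row misses
  just one.\<close>

lemma card_row_Int_col:
  assumes "(2::'a::{field,finite}) \<noteq> 0"
  shows "card (rsym (i :: 'a option) \<inter> csym c) = CARD('a)"
proof (cases c)
  case (Pair t j)
  have "rsym i \<inter> csym c = csym c - csym c \<inter> punctured_line i"
    unfolding row_symbols_plane_array[OF assms] by blast
  then show ?thesis
    using card_punctured_line_Int[of t j i]
    by (simp add: Pair col_symbols_plane_array card_Diff_subset)
qed

section \<open>The triple array property\<close>

lemma extremal_triple_array_plane_array:
  assumes "(2::'a::{field,finite}) \<noteq> 0"
  shows "extremal_triple_array (CARD('a) + 1) (CARD('a)\<^sup>2) (CARD('a) * (CARD('a) + 1))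
           (UNIV :: 'a option set) (UNIV :: ('a \<times> 'a) set) array_symbols plane_array"
proof -
  let ?s = "CARD('a)"
  have s: "?s \<ge> 2" by (rule card_field_ge_2)
  then have s2: "?s\<^sup>2 \<ge> 2"
    using power_increasing[of 1 2 ?s] by simp
  have card_V: "card (array_symbols :: 'a pg_point set) = ?s * (?s + 1)"
    by (simp add: array_symbols_eq card_Diff_subset card_UNIV_pg_point power2_eq_square)
  have "plane_array i c \<noteq> AtInf None" for i :: "'a option" and c
    by (cases i; cases c) auto
  then have array: "is_array (?s + 1) (?s\<^sup>2) (?s * (?s + 1))
      (UNIV :: 'a option set) UNIV array_symbols plane_array"
    using card_V by (simp add: is_array_def array_symbols_eq power2_eq_square)
  have binary: "binary_array (UNIV :: 'a option set) UNIV plane_array"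
    using inj_on_plane_array_row[OF assms] inj_on_plane_array_col
    unfolding binary_array_def by blast
  have equi: "equireplicate (UNIV :: 'a option set) UNIV array_symbols plane_array"
    unfolding equireplicate_def
    using card_occurrences[OF assms] card_V
    \<comment> \<open>The replication number is the field order, cells divided by symbols.\<close>
    by (intro exI[of _ ?s]) (simp add: array_symbols_eq algebra_simps)
  have CC: "card (csym c \<inter> csym c') = 1" if "c \<noteq> c'" for c c' :: "'a \<times> 'a"
    using that by (cases c; cases c') (simp only: col_symbols_plane_array card_projective_closure_Int)
  show ?thesis
    unfolding extremal_triple_array_def triple_array_def
  proof (intro conjI)
    show "\<exists>lRR. \<forall>i\<in>UNIV. \<forall>i'\<in>UNIV. i \<noteq> i' \<longrightarrow> card (rsym i \<inter> rsym (i' :: 'a option)) = lRR"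
      using card_row_Int_row[OF assms] by blast
    show "\<exists>lCC. \<forall>c\<in>UNIV. \<forall>c'\<in>UNIV. c \<noteq> c' \<longrightarrow> card (csym c \<inter> csym (c' :: 'a \<times> 'a)) = lCC"
      using CC by blast
    show "\<exists>lRC. \<forall>i\<in>UNIV. \<forall>c\<in>UNIV. card (rsym (i :: 'a option) \<inter> csym c) = lRC"
      using card_row_Int_col[OF assms] by blast
    show "?s * (?s + 1) = ?s + 1 + ?s\<^sup>2 - 1"
      by (simp add: power2_eq_square)
  qed (use s s2 array binary equi in auto)
qed

section \<open>The marginals\<close>

text \<open>Designs are multisets of blocks, while \<open>punctured_pair\<close> has each block
  once. So besides equal ranges, injectivity of \<open>rsym\<close> and \<open>csym\<close> is
  required.\<close>

lemma marginals_plane_array: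
  assumes "(2::'a::{field,finite}) \<noteq> 0"
  shows "marginals (UNIV :: 'a option set) (UNIV :: ('a \<times> 'a) set) array_symbols plane_array =
           punctured_pair (UNIV :: 'a pg_point set) pg_lines (AtInf None)"
proof -
  have "inj (rsym :: 'a option \<Rightarrow> _)"
  proof (rule injI)
    fix i i' :: "'a option" assume "rsym i = rsym i'"
    then have "punctured_line i \<inter> punctured_line i' = punctured_line i"
      unfolding row_symbols_plane_array[OF assms] by blast
    \<comment> \<open>Distinct lines through \<open>AtInf None\<close> would share a single point,
      not \<open>CARD('a) + 1\<close> of them.\<close>
    then have "card (punctured_line i \<inter> punctured_line i') = CARD('a) + 1"
      by (simp only: card_punctured_line)
    then show "i = i'"
      using punctured_line_Int[OF assms, of i i'] by (cases "i = i'") simp_all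
  qed
  moreover have "range (rsym :: 'a option \<Rightarrow> _) = {UNIV - l | l. l \<in> pg_lines \<and> AtInf None \<in> l}"
  proof -
    have "range (punctured_line :: 'a option \<Rightarrow> _) = {l \<in> pg_lines. AtInf None \<in> l}"
    proof (intro equalityI subsetI)
      fix l :: "'a pg_point set" assume "l \<in> range punctured_line"
      then obtain i where "l = punctured_line i" by blast
      then show "l \<in> {l \<in> pg_lines. AtInf None \<in> l}"
        by (cases i) (auto simp: pg_lines_def)
    next
      fix l :: "'a pg_point set" assume "l \<in> {l \<in> pg_lines. AtInf None \<in> l}"
      then consider "l = line_at_infinity" | c where "l = projective_closure None c"
        by (auto simp: pg_lines_def)
      then show "l \<in> range punctured_line"
      proof cases
        case 1
        then show ?thesis by (intro range_eqI[of _ _ None]) simp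
      next
        case 2
        \<comment> \<open>Every vertical line avoids some row because its abscissa can be
          halved.\<close>
        then show ?thesis using assms by (intro range_eqI[of _ _ "Some (c / 2)"]) simp
      qed
    qed
    then have "(\<lambda>l. UNIV - l) ` range (punctured_line :: 'a option \<Rightarrow> _)
        = (\<lambda>l. UNIV - l) ` {l \<in> pg_lines. AtInf None \<in> l}"
      by (rule arg_cong)
    moreover have "range (rsym :: 'a option \<Rightarrow> _) = (\<lambda>l. UNIV - l) ` range punctured_line"
      unfolding row_symbols_plane_array[OF assms] by (simp add: image_image)
    ultimately show ?thesis by (simp add: setcompr_eq_image)
  qed
  moreover have "inj (csym :: 'a \<times> 'a \<Rightarrow> _)"
  proof (rule injI)
    fix c c' :: "'a \<times> 'a" assume eq: "csym c = csym c'"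
    obtain t j t' j' where c: "c = (t, j)" "c' = (t', j')"
      by (metis surj_pair)
    show "c = c'"
    proof (rule ccontr)
      assume "c \<noteq> c'"
      then have "card (csym c \<inter> csym c') = 1"
        unfolding c col_symbols_plane_array by (intro card_projective_closure_Int)
      then show False
        using eq by (simp add: c col_symbols_plane_array)
    qed
  qed
  moreover have "range (csym :: 'a \<times> 'a \<Rightarrow> _) = {l \<in> pg_lines. AtInf None \<notin> l}"
  proof (intro equalityI subsetI)
    fix l :: "'a pg_point set" assume "l \<in> range csym"
    then obtain t j where "l = projective_closure (Some t) j"
      by (auto simp: col_symbols_plane_array)
    then show "l \<in> {l \<in> pg_lines. AtInf None \<notin> l}"
      unfolding pg_lines_def using mem_projective_closure(1) by blast
  next
    fix l :: "'a pg_point set" assume l: "l \<in> {l \<in> pg_lines. AtInf None \<notin> l}"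
    then obtain u j where "l = projective_closure u j"
      by (auto simp: pg_lines_def)
    \<comment> \<open>Slope \<open>None\<close> is excluded since \<open>l\<close> misses
      \<open>AtInf None\<close>.\<close>
    moreover from this l obtain t where "u = Some t"
      by (cases u) auto
    ultimately have "l = projective_closure (Some t) j"
      by simp
    then show "l \<in> range csym"
      by (intro range_eqI[of _ _ "(t, j)"]) (simp add: col_symbols_plane_array)
  qed
  ultimately show ?thesis
    by (simp add: marginals_def row_design_def col_design_def punctured_pair_def
        array_symbols_eq image_mset_mset_set)
qed

theorem mainTheorem2:
  fixes s :: nat
  assumes "CARD('a::{field,finite}) = s" and "odd s"
  shows "extremal_triple_array (s + 1) (s\<^sup>2) (s * (s + 1))
           (UNIV :: 'a option set) (UNIV :: ('a \<times> 'a) set) array_symbols plane_array \<and>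
         marginals (UNIV :: 'a option set) (UNIV :: ('a \<times> 'a) set) array_symbols plane_array =
           punctured_pair (UNIV :: 'a pg_point set) pg_lines (AtInf None)"
proof -
  have "(2::'a) \<noteq> 0"
    using assms two_neq_zero_if_odd_card by blast
  then show ?thesis
    using assms extremal_triple_array_plane_array marginals_plane_array by blast
qed

end
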